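(* Let $\mathbf A=(A,\sqcup,\sqcap,{}')$ be a $\lambda$-lattice with a unary operation $'$ such that for all $x,y\in A$ $$x\sqcup y'\le y'\sqcup\big((x\sqcup y')\sqcap y\big)\quad\text{and}\quad\big(x'\sqcup(x\sqcap y)\big)\sqcap x\le x\sqcap y,$$ and let $\odot$ and $\to$ denote the Sasaki operations on $A$, i.e. $x\odot y:=(x\sqcup y')\sqcap y$ and $x\to y:=x'\sqcup(x\sqcap y)$ for all $x,y\in A$. Then the following are equivalent: (i) The operations $\odot$ and $\to$ form an adjoint pair. (ii) For all $x,y,z\in A$: $x\le y$ implies $z'\sqcup(z\sqcap x)\le z'\sqcup(z\sqcap y)$, and $x\le y$ implies $(x\sqcup z')\sqcap z\le(y\sqcup z')\sqcap z$. (iii) For all $x,y,z\in A$: $x\odot y\le z$ implies $y'\sqcup\big(y\sqcap(x\odot y)\big)\le y'\sqcup(y\sqcap z)$, and $x\le y\to z$ implies $(x\sqcup y')\sqcap y\le\big((y\to z)\sqcup y'\big)\sqcap y$.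
   Context: A $\lambda$-lattice is an algebra $(A,\sqcup,\sqcap)$ with two binary operations satisfying the identities $x\sqcup y\approx y\sqcup x$, $x\sqcap y\approx y\sqcap x$, $x\sqcup\big((x\sqcup y)\sqcup z\big)\approx(x\sqcup y)\sqcup z$, $x\sqcap\big((x\sqcap y)\sqcap z\big)\approx(x\sqcap y)\sqcap z$, $x\sqcup(x\sqcap y)\approx x$, $x\sqcap(x\sqcup y)\approx x$. Its induced order $\le$, which is a partial order on $A$, is defined by $x\le y$ if and only if $x\sqcup y=y$ (equivalently, $x\sqcap y=x$). The unary operation $'$ is arbitrary. Two binary operations $\odot$ and $\to$ on a poset $(A,\le)$ form an adjoint pair if for all $x,y,z\in A$: $x\odot y\le z$ if and only if $x\le y\to z$. *)

theory Defs
  imports Main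
begin

locale lambda_lattice =
  fixes join :: "'a \<Rightarrow> 'a \<Rightarrow> 'a" (infixl "\<squnion>" 65)
    and meet :: "'a \<Rightarrow> 'a \<Rightarrow> 'a" (infixl "\<sqinter>" 70)
  assumes join_commute: "x \<squnion> y = y \<squnion> x"
    and meet_commute: "x \<sqinter> y = y \<sqinter> x"
    and join_skew_assoc: "x \<squnion> ((x \<squnion> y) \<squnion> z) = (x \<squnion> y) \<squnion> z"
    and meet_skew_assoc: "x \<sqinter> ((x \<sqinter> y) \<sqinter> z) = (x \<sqinter> y) \<sqinter> z"
    and join_absorb: "x \<squnion> (x \<sqinter> y) = x"
    and meet_absorb: "x \<sqinter> (x \<squnion> y) = x"

definition induced_le :: "('a \<Rightarrow> 'a \<Rightarrow> 'a) \<Rightarrow> 'a \<Rightarrow> 'a \<Rightarrow> bool" where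
  "induced_le join x y \<longleftrightarrow> join x y = y"

definition sasaki_prod ::
    "('a \<Rightarrow> 'a \<Rightarrow> 'a) \<Rightarrow> ('a \<Rightarrow> 'a \<Rightarrow> 'a) \<Rightarrow> ('a \<Rightarrow> 'a) \<Rightarrow> 'a \<Rightarrow> 'a \<Rightarrow> 'a" where
  "sasaki_prod join meet compl x y = meet (join x (compl y)) y"

definition sasaki_imp ::
    "('a \<Rightarrow> 'a \<Rightarrow> 'a) \<Rightarrow> ('a \<Rightarrow> 'a \<Rightarrow> 'a) \<Rightarrow> ('a \<Rightarrow> 'a) \<Rightarrow> 'a \<Rightarrow> 'a \<Rightarrow> 'a" where
  "sasaki_imp join meet compl x y = join (compl x) (meet x y)"

(* That le is a partial order is not part of the definition; for the induced order of a
   lambda-lattice it is proved below. *)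
definition adjoint_pair ::
    "('a \<Rightarrow> 'a \<Rightarrow> bool) \<Rightarrow> ('a \<Rightarrow> 'a \<Rightarrow> 'a) \<Rightarrow> ('a \<Rightarrow> 'a \<Rightarrow> 'a) \<Rightarrow> bool" where
  "adjoint_pair le prd imp \<longleftrightarrow> (\<forall>x y z. le (prd x y) z \<longleftrightarrow> le x (imp y z))"

context lambda_lattice
begin

lemma induced_le_iff_meet: "induced_le (\<squnion>) x y \<longleftrightarrow> x \<sqinter> y = x"
  unfolding induced_le_def by (metis join_commute meet_commute join_absorb meet_absorb)

lemma induced_le_refl: "induced_le (\<squnion>) x x"
  unfolding induced_le_def by (metis join_absorb meet_absorb)

lemma induced_le_antisym:
  "induced_le (\<squnion>) x y \<Longrightarrow> induced_le (\<squnion>) y x \<Longrightarrow> x = y"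
  unfolding induced_le_def by (metis join_commute)

lemma induced_le_trans:
  "induced_le (\<squnion>) x y \<Longrightarrow> induced_le (\<squnion>) y z \<Longrightarrow> induced_le (\<squnion>) x z"
  unfolding induced_le_def by (metis join_skew_assoc)

end

end

theory Submission
  imports Defs
begin

text \<open>The two hypotheses on the complement are the unit and counit inequalities
  \<open>x \<le> y \<rightarrow> (x \<odot> y)\<close> and \<open>(y \<rightarrow> z) \<odot> y \<le> z\<close> in disguise. Adjointness forces both operations
  to be monotone, and (iii) is the part of this monotonicity that yields adjointness from the
  unit and counit.\<close>

text \<open>Standard for Galois connections: each claim transposes to an inequality obtained by
  composing a counit or unit with \<open>le x y\<close>.\<close>

lemma adjoint_pair_mono:
  assumes "adjoint_pair le prd imp" and "reflp le" and "transp le" and "le x y"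
  shows "le (imp z x) (imp z y)" and "le (prd x z) (prd y z)"
proof -
  have adj: "le (prd a b) c \<longleftrightarrow> le a (imp b c)" for a b c
    using assms(1) unfolding adjoint_pair_def by blast
  \<comment> \<open>Counit and unit are transposes of reflexivity. The counit is taken at the
    smaller element \<open>x\<close> and the unit at the larger \<open>y\<close>, so that
    \<open>le x y\<close> extends the one on the right and the other on the left.\<close>
  have "le (prd (imp z x) z) x" and "le y (imp z (prd y z))"
    using adj reflpD[OF assms(2)] by blast+
  then have "le (prd (imp z x) z) y" and "le x (imp z (prd y z))"
    using transpD[OF assms(3)] assms(4) by blast+
  then show "le (imp z x) (imp z y)" and "le (prd x z) (prd y z)"
    using adj by blast+
qed

context lambda_lattice
begin

text \<open>In a \<lambda>-lattice, join and meet need not be least upper or greatest lower bounds,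
  nor monotone. The main argument therefore relies only on their being bounds.\<close>

lemma join_upper1: "induced_le (\<squnion>) x (x \<squnion> y)"
  unfolding induced_le_iff_meet by (rule meet_absorb)

lemma meet_lower1: "induced_le (\<squnion>) (x \<sqinter> y) x"
  unfolding induced_le_def by (metis join_absorb join_commute)

lemma meet_lower2: "induced_le (\<squnion>) (x \<sqinter> y) y"
  by (metis meet_lower1 meet_commute)

lemma reflp_induced_le: "reflp (induced_le (\<squnion>))"
  by (rule reflpI) (rule induced_le_refl)

lemma transp_induced_le: "transp (induced_le (\<squnion>))"
  by (rule transpI) (rule induced_le_trans)

end

theorem theorem3p6:
  fixes join :: "'a \<Rightarrow> 'a \<Rightarrow> 'a" (infixl "\<squnion>" 65)
    and meet :: "'a \<Rightarrow> 'a \<Rightarrow> 'a" (infixl "\<sqinter>" 70)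
    and compl :: "'a \<Rightarrow> 'a" ("_\<^sup>c" [1000] 999)
    and le :: "'a \<Rightarrow> 'a \<Rightarrow> bool" (infix "\<sqsubseteq>" 50)
    and prd :: "'a \<Rightarrow> 'a \<Rightarrow> 'a" (infixl "\<odot>" 70)
    and imp :: "'a \<Rightarrow> 'a \<Rightarrow> 'a" (infixr "\<rightarrow>" 60)
  assumes "lambda_lattice (\<squnion>) (\<sqinter>)"
    and "(\<sqsubseteq>) = induced_le (\<squnion>)"
    and "\<And>x y. x \<squnion> y\<^sup>c \<sqsubseteq> y\<^sup>c \<squnion> ((x \<squnion> y\<^sup>c) \<sqinter> y)"
    and "\<And>x y. (x\<^sup>c \<squnion> (x \<sqinter> y)) \<sqinter> x \<sqsubseteq> x \<sqinter> y"
    and "(\<odot>) = sasaki_prod (\<squnion>) (\<sqinter>) compl"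
    and "(\<rightarrow>) = sasaki_imp (\<squnion>) (\<sqinter>) compl"
  shows "(adjoint_pair (\<sqsubseteq>) (\<odot>) (\<rightarrow>) \<longleftrightarrow>
      (\<forall>x y z.
        (x \<sqsubseteq> y \<longrightarrow> z\<^sup>c \<squnion> (z \<sqinter> x) \<sqsubseteq> z\<^sup>c \<squnion> (z \<sqinter> y)) \<and>
        (x \<sqsubseteq> y \<longrightarrow> (x \<squnion> z\<^sup>c) \<sqinter> z \<sqsubseteq> (y \<squnion> z\<^sup>c) \<sqinter> z))) \<and>
    ((\<forall>x y z.
        (x \<sqsubseteq> y \<longrightarrow> z\<^sup>c \<squnion> (z \<sqinter> x) \<sqsubseteq> z\<^sup>c \<squnion> (z \<sqinter> y)) \<and>
        (x \<sqsubseteq> y \<longrightarrow> (x \<squnion> z\<^sup>c) \<sqinter> z \<sqsubseteq> (y \<squnion> z\<^sup>c) \<sqinter> z)) \<longleftrightarrow>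
      (\<forall>x y z.
        (x \<odot> y \<sqsubseteq> z \<longrightarrow> y\<^sup>c \<squnion> (y \<sqinter> (x \<odot> y)) \<sqsubseteq> y\<^sup>c \<squnion> (y \<sqinter> z)) \<and>
        (x \<sqsubseteq> y \<rightarrow> z \<longrightarrow> (x \<squnion> y\<^sup>c) \<sqinter> y \<sqsubseteq> ((y \<rightarrow> z) \<squnion> y\<^sup>c) \<sqinter> y)))"
proof -
  interpret lambda_lattice "(\<squnion>)" "(\<sqinter>)" by (rule assms(1))
  note trans = transpD[OF transp_induced_le, folded assms(2)]
  have prd: "x \<odot> y = (x \<squnion> y\<^sup>c) \<sqinter> y" and imp: "x \<rightarrow> y = x\<^sup>c \<squnion> (x \<sqinter> y)" for x y
    by (simp_all add: assms(5,6) sasaki_prod_def sasaki_imp_def)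
  let ?i = "adjoint_pair (\<sqsubseteq>) (\<odot>) (\<rightarrow>)"
  let ?ii = "\<forall>x y z.
        (x \<sqsubseteq> y \<longrightarrow> z\<^sup>c \<squnion> (z \<sqinter> x) \<sqsubseteq> z\<^sup>c \<squnion> (z \<sqinter> y)) \<and>
        (x \<sqsubseteq> y \<longrightarrow> (x \<squnion> z\<^sup>c) \<sqinter> z \<sqsubseteq> (y \<squnion> z\<^sup>c) \<sqinter> z)"
  let ?iii = "\<forall>x y z.
        (x \<odot> y \<sqsubseteq> z \<longrightarrow> y\<^sup>c \<squnion> (y \<sqinter> (x \<odot> y)) \<sqsubseteq> y\<^sup>c \<squnion> (y \<sqinter> z)) \<and>
        (x \<sqsubseteq> y \<rightarrow> z \<longrightarrow> (x \<squnion> y\<^sup>c) \<sqinter> y \<sqsubseteq> ((y \<rightarrow> z) \<squnion> y\<^sup>c) \<sqinter> y)"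
  \<comment> \<open>With both operations unfolded, (ii) says exactly that \<rightarrow> is monotone
    in its second argument and \<odot> in its first.\<close>
  have "?ii" if "?i"
    using adjoint_pair_mono[OF that] reflp_induced_le transp_induced_le
    unfolding assms(2)[symmetric] prd imp by blast
  \<comment> \<open>Instances of (ii) with parameter \<open>y\<close>: the pair
    \<open>x \<odot> y\<close>, \<open>z\<close> for the first half and \<open>x\<close>,
    \<open>y \<rightarrow> z\<close> for the second.\<close>
  moreover have "?iii" if "?ii"
    using that by blast
  moreover have "?i" if iii: "?iii"
    unfolding adjoint_pair_def
  proof (intro allI iffI)
    fix x y z
    assume "x \<odot> y \<sqsubseteq> z"
    then have le: "y\<^sup>c \<squnion> (y \<sqinter> (x \<odot> y)) \<sqsubseteq> y \<rightarrow> z"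
      using iii unfolding imp by blast
    \<comment> \<open>Since \<open>x \<odot> y\<close> is a meet with \<open>y\<close>, it lies
      below \<open>y\<close>. Hence \<open>y \<rightarrow> (x \<odot> y)\<close> reduces to the
      right-hand side of the first hypothesis on the complement, and the chain is \<open>x
      \<sqsubseteq> x \<squnion> y\<^sup>c \<sqsubseteq> y \<rightarrow> (x \<odot> y) \<sqsubseteq>
      y \<rightarrow> z\<close>.\<close>
    have "y \<sqinter> (x \<odot> y) = x \<odot> y"
      using meet_lower2 unfolding prd by (metis induced_le_iff_meet meet_commute)
    then have "x \<squnion> y\<^sup>c \<sqsubseteq> y\<^sup>c \<squnion> (y \<sqinter> (x \<odot> y))"
      using assms(3) by (simp add: prd)
    moreover have "x \<sqsubseteq> x \<squnion> y\<^sup>c"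
      unfolding assms(2) by (rule join_upper1)
    ultimately show "x \<sqsubseteq> y \<rightarrow> z"
      using le trans by blast
  next
    fix x y z
    assume "x \<sqsubseteq> y \<rightarrow> z"
    then have le: "x \<odot> y \<sqsubseteq> ((y \<rightarrow> z) \<squnion> y\<^sup>c) \<sqinter> y"
      using iii unfolding prd by blast
    \<comment> \<open>Dually, \<open>y \<rightarrow> z\<close> is a join with
      \<open>y\<^sup>c\<close> and so absorbs it. This turns
      \<open>(y \<rightarrow> z) \<odot> y\<close> into the left-hand side of the second hypothesis,
      giving \<open>x \<odot> y \<sqsubseteq> (y \<rightarrow> z) \<odot> y \<sqsubseteq> y
      \<sqinter> z \<sqsubseteq> z\<close>.\<close>
    have "(y \<rightarrow> z) \<squnion> y\<^sup>c = y \<rightarrow> z"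
      using join_upper1 unfolding imp induced_le_def by (metis join_commute)
    then have "((y \<rightarrow> z) \<squnion> y\<^sup>c) \<sqinter> y \<sqsubseteq> y \<sqinter> z"
      using assms(4) by (simp add: imp)
    moreover have "y \<sqinter> z \<sqsubseteq> z"
      unfolding assms(2) by (rule meet_lower2)
    ultimately show "x \<odot> y \<sqsubseteq> z"
      using le trans by blast
  qed
  ultimately show ?thesis by blast
qed

end
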